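(* Let $D$ be either the upper half-plane $\mathbb{H}^2$ or the unit disk $\mathbb{B}^2$. Then the modulus metric $\mu_D$ is not Hölder continuous with respect to the hyperbolic metric $\rho_D$; that is, there do not exist constants $C>0$ and $\alpha>0$ such that $\mu_D(x,y)\le C\,\rho_D(x,y)^{\alpha}$ for all $x,y\in D$.
   Context: $\mathbb{B}^2=\{x\in\mathbb{R}^2:|x|<1\}$ and $\mathbb{H}^2=\{x=(x_1,x_2)\in\mathbb{R}^2: x_2>0\}$. Modulus of a curve family: for a family $\Gamma$ of curves in $\mathbb{R}^2$, $\mathsf{M}(\Gamma)=\inf_{\sigma}\int_{\mathbb{R}^2}\sigma^2\,dm$, where $m$ is Lebesgue measure and the infimum is over all Borel functions $\sigma:\mathbb{R}^2\to[0,\infty]$ with $\int_\gamma\sigma\,ds\ge 1$ for every locally rectifiable curve $\gamma\in\Gamma$. For nonempty sets $E,F$ and a domain $G$, $\Delta(E,F;G)$ is the family of all curves joining $E$ and $F$ in $G$ (one endpoint in $E$, the other in $F$, and all non-endpoint points of the curve in $G$). Modulus metric: for a domain $G$, $\mu_G(x,y)=\inf_{C_{xy}}\mathsf{M}(\Delta(C_{xy},\partial G;G))$ for $x,y\in G$, where the infimum is over all continua (compact connected sets, possibly a single point) $C_{xy}\subset G$ containing both $x$ and $y$. For $D\in\{\mathbb{H}^2,\mathbb{B}^2\}$, $\mu_D$ is a metric on $D$. Hyperbolic metric (curvature $-1$): on $\mathbb{B}^2$, $\sinh^2(\rho_{\mathbb{B}^2}(x,y)/2)=\dfrac{|x-y|^2}{(1-|x|^2)(1-|y|^2)}$;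 on $\mathbb{H}^2$ it is obtained by conformal invariance, i.e. $\cosh\rho_{\mathbb{H}^2}(x,y)=1+\dfrac{|x-y|^2}{2x_2y_2}$. *)

theory Defs
  imports "HOL-Analysis.Analysis"
begin

section \<open>Length and line integrals of curves\<close>

text \<open>A curve is a library \<^const>\<open>path\<close>, i.e. continuous on the parameter interval [0,1]. The
  length of its restriction to [a,b] is the supremum of the lengths of inscribed polygons.\<close>

definition curve_length :: "(real \<Rightarrow> real^2) \<Rightarrow> real \<Rightarrow> real \<Rightarrow> ennreal" where
  "curve_length g a b =
     (SUP ts \<in> {ts. sorted ts \<and> set ts \<subseteq> {a..b}}.
        \<Sum>i<length ts - 1. ennreal (dist (g (ts ! i)) (g (ts ! Suc i))))"

text \<open>As the parameter interval is compact, a curve is locally rectifiable (all its compact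
  subcurves have finite length) iff its total length is finite.\<close>

definition rectifiable_path :: "(real \<Rightarrow> real^2) \<Rightarrow> bool" where
  "rectifiable_path g \<longleftrightarrow> path g \<and> curve_length g 0 1 < \<infinity>"

text \<open>Arc-length parametrization of a rectifiable curve, on [0,L] with L the total length.
  The length function is continuous and increasing from 0 to L, so a suitable parameter exists;
  g is constant on each of its level sets, so the value does not depend on the parameter chosen.\<close>

definition arc_length_param :: "(real \<Rightarrow> real^2) \<Rightarrow> real \<Rightarrow> real^2" where
  "arc_length_param g u = g (SOME t. t \<in> {0..1} \<and> curve_length g 0 t = ennreal u)"

definition line_integral :: "(real^2 \<Rightarrow> ennreal) \<Rightarrow> (real \<Rightarrow> real^2) \<Rightarrow> ennreal" where
  "line_integral \<sigma> g =
     (\<integral>\<^sup>+u\<in>{0..enn2real (curve_length g 0 1)}. \<sigma> (arc_length_param g u) \<partial>lborel)"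

section \<open>Modulus of a curve family and the modulus metric\<close>

definition admissible :: "(real \<Rightarrow> real^2) set \<Rightarrow> (real^2 \<Rightarrow> ennreal) set" where
  "admissible \<Gamma> = {\<sigma> \<in> borel_measurable borel.
     \<forall>g\<in>\<Gamma>. rectifiable_path g \<longrightarrow> 1 \<le> line_integral \<sigma> g}"

definition modulus :: "(real \<Rightarrow> real^2) set \<Rightarrow> ennreal" where
  "modulus \<Gamma> = (INF \<sigma>\<in>admissible \<Gamma>. \<integral>\<^sup>+x. (\<sigma> x)\<^sup>2 \<partial>lborel)"

definition joining_curves :: "(real^2) set \<Rightarrow> (real^2) set \<Rightarrow> (real^2) set \<Rightarrow> (real \<Rightarrow> real^2) set"
  where
  "joining_curves E F G = {g. path g \<and>
     (pathstart g \<in> E \<and> pathfinish g \<in> F \<or> pathstart g \<in> F \<and> pathfinish g \<in> E) \<and>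
     (\<forall>t\<in>{0<..<1}. g t \<in> G)}"

definition modulus_metric :: "(real^2) set \<Rightarrow> real^2 \<Rightarrow> real^2 \<Rightarrow> ennreal" where
  "modulus_metric G x y =
     (INF K\<in>{K. compact K \<and> connected K \<and> K \<subseteq> G \<and> x \<in> K \<and> y \<in> K}.
        modulus (joining_curves K (frontier G) G))"

section \<open>The two domains and their hyperbolic metrics\<close>

definition upper_half_plane :: "(real^2) set" where
  "upper_half_plane = {x. 0 < x $ 2}"

definition unit_disk :: "(real^2) set" where
  "unit_disk = ball 0 1"

definition rho_half_plane :: "real^2 \<Rightarrow> real^2 \<Rightarrow> real" where
  "rho_half_plane x y = arcosh (1 + (norm (x - y))\<^sup>2 / (2 * x $ 2 * y $ 2))"

definition rho_disk :: "real^2 \<Rightarrow> real^2 \<Rightarrow> real" where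
  "rho_disk x y =
     2 * arsinh (sqrt ((norm (x - y))\<^sup>2 / ((1 - (norm x)\<^sup>2) * (1 - (norm y)\<^sup>2))))"

text \<open>The defining equations of the metrics, of which the above are the nonnegative solutions.\<close>

lemma cosh_rho_half_plane:
  assumes "x \<in> upper_half_plane" "y \<in> upper_half_plane"
  shows "cosh (rho_half_plane x y) = 1 + (norm (x - y))\<^sup>2 / (2 * x $ 2 * y $ 2)"
    and "0 \<le> rho_half_plane x y"
proof -
  have "0 \<le> (norm (x - y))\<^sup>2 / (2 * x $ 2 * y $ 2)"
    using assms by (simp add: upper_half_plane_def)
  then show "cosh (rho_half_plane x y) = 1 + (norm (x - y))\<^sup>2 / (2 * x $ 2 * y $ 2)"
    and "0 \<le> rho_half_plane x y"
    by (simp_all add: rho_half_plane_def)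
qed

lemma sinh_rho_disk:
  assumes "x \<in> unit_disk" "y \<in> unit_disk"
  shows "(sinh (rho_disk x y / 2))\<^sup>2 =
           (norm (x - y))\<^sup>2 / ((1 - (norm x)\<^sup>2) * (1 - (norm y)\<^sup>2))"
    and "0 \<le> rho_disk x y"
proof -
  have "(norm x)\<^sup>2 < 1" "(norm y)\<^sup>2 < 1"
    using assms by (simp_all add: unit_disk_def abs_square_less_1)
  then have "0 \<le> (norm (x - y))\<^sup>2 / ((1 - (norm x)\<^sup>2) * (1 - (norm y)\<^sup>2))"
    by simp
  then show "(sinh (rho_disk x y / 2))\<^sup>2 =
           (norm (x - y))\<^sup>2 / ((1 - (norm x)\<^sup>2) * (1 - (norm y)\<^sup>2))"
    and "0 \<le> rho_disk x y"
    by (simp_all add: rho_disk_def flip: not_less)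
qed

end

theory Submission
  imports Defs "HOL-Real_Asymp.Real_Asymp"
begin

text \<open>Why the modulus metric is not Hoelder continuous: near the diagonal it decays only like the
  reciprocal of a logarithm, \<open>\<mu>\<^sub>D(x, y) \<ge> c / ln (1 / \<rho>\<^sub>D(x, y))\<close>, and this exceeds
  \<open>C * \<rho>\<^sub>D(x, y) powr \<alpha>\<close> for small distances, whatever \<open>C\<close> and \<open>\<alpha>\<close> are.

  It suffices to see this for one point \<open>x0\<close> of the domain and the points \<open>y\<close> at
  horizontal distance \<open>2 * r\<close> from it, and to bound the modulus from below, with the same
  constants for every continuum \<open>K\<close> containing \<open>x0\<close> and \<open>y\<close>. The centre \<open>x0\<close> (the origin of
  the disk, the point at height one of the half-plane) is chosen so that the domain contains the
  unit disk about it, while the downward rays from \<open>x0\<close> with direction \<open>(m, -1)\<close>, where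
  \<open>0 \<le> m \<le> 1\<close>, leave the domain no later than at time one.

  For every \<open>s\<close> between \<open>r\<close> and \<open>2 * r\<close>, the connected set \<open>K\<close> meets the boundary of the square
  of half-side \<open>s\<close> about \<open>x0\<close> (\<open>connected_meets_square\<close>). Nothing is known about the
  point of intersection; but from it one can walk along the sides of the square to its
  lower side, to the point \<open>s * (m, -1)\<close>, and from there along the ray to the
  boundary of the domain. If \<open>\<sigma>\<close> is admissible, its integral along this polygon is at least one,
  and it is at most a fixed multiple of the integral over the lines carrying the sides of the square,
  plus twice the integral over the ray. This upper bound no longer depends on where \<open>K\<close> meets the
  square, so that it can be averaged over \<open>s\<close> and \<open>m\<close>. By Fubini's theorem the average is the
  integral of \<open>\<sigma>\<close> against an explicit weight: a multiple of \<open>1 / r\<close> on the square of half-side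
  \<open>2 * r\<close>, plus a multiple of the reciprocal of the depth below \<open>x0\<close> on the cone of the rays
  (\<open>averaged_box_cone_bound\<close>). The square of the weight has integral at most
  \<open>800 + 8 * ln (1 / r)\<close>, the logarithm stemming from the cone, and the Cauchy-Schwarz inequality
  gives the lower bound for the integral of the square of \<open>\<sigma>\<close>
  (\<open>Cauchy_Schwarz_box_cone\<close>, \<open>modulus_metric_ge_log\<close>).

  Polygons suffice as test curves, which keeps arc length elementary: parametrized by unit speed, a
  polygon is its own arc-length parametrization, and line integrals become ordinary integrals over
  an interval (\<open>line_integral_unit_speed\<close>).\<close>

section \<open>Lengths of Lipschitz curves and of extended curves\<close>

lemma curve_length_Lipschitz_le:
  assumes "a \<le> b" "0 \<le> c"
    and lip: "\<And>u v. u \<in> {a..b} \<Longrightarrow> v \<in> {a..b} \<Longrightarrow> dist (g u) (g v) \<le> c * \<bar>u - v\<bar>"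
  shows "curve_length g a b \<le> ennreal (c * (b - a))"
  unfolding curve_length_def
proof (rule SUP_least)
  fix ts :: "real list" assume "ts \<in> {ts. sorted ts \<and> set ts \<subseteq> {a..b}}"
  then have ts: "sorted ts" "set ts \<subseteq> {a..b}" by auto
  show "(\<Sum>i<length ts - 1. ennreal (dist (g (ts ! i)) (g (ts ! Suc i)))) \<le> ennreal (c * (b - a))"
  proof (cases "ts = []")
    case True
    then show ?thesis by simp
  next
    case False
    have mem: "ts ! i \<in> {a..b}" if "i < length ts" for i
      using ts(2) that nth_mem by blast
    have "(\<Sum>i<length ts - 1. ennreal (dist (g (ts ! i)) (g (ts ! Suc i))))
        \<le> (\<Sum>i<length ts - 1. ennreal (c * (ts ! Suc i - ts ! i)))"
    proof (intro sum_mono ennreal_leI)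
      fix i assume "i \<in> {..<length ts - 1}"
      then have i: "i < length ts" "Suc i < length ts" by auto
      moreover have "ts ! i \<le> ts ! Suc i"
        using ts(1) i by (simp add: sorted_nth_mono)
      ultimately show "dist (g (ts ! i)) (g (ts ! Suc i)) \<le> c * (ts ! Suc i - ts ! i)"
        using lip[OF mem[OF i(1)] mem[OF i(2)]] by simp
    qed
    also have "\<dots> = ennreal (\<Sum>i<length ts - 1. c * (ts ! Suc i - ts ! i))"
      using ts(1) assms(2) by (intro sum_ennreal) (auto intro!: mult_nonneg_nonneg sorted_nth_mono)
    also have "(\<Sum>i<length ts - 1. c * (ts ! Suc i - ts ! i)) = c * (ts ! (length ts - 1) - ts ! 0)"
      by (simp add: sum_lessThan_telescope flip: sum_distrib_left)
    also have "ennreal \<dots> \<le> ennreal (c * (b - a))"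
      using mem[of 0] mem[of "length ts - 1"] False assms(2)
      by (intro ennreal_leI mult_left_mono) auto
    finally show ?thesis .
  qed
qed

lemma curve_length_cong:
  assumes "\<And>u. u \<in> {a..b} \<Longrightarrow> g u = h u"
  shows "curve_length g a b = curve_length h a b"
  unfolding curve_length_def
proof (rule SUP_cong[OF refl], rule sum.cong[OF refl])
  fix ts :: "real list" and i
  assume "ts \<in> {ts. sorted ts \<and> set ts \<subseteq> {a..b}}" "i \<in> {..<length ts - 1}"
  then have "ts ! i \<in> {a..b}" "ts ! Suc i \<in> {a..b}"
    by (auto simp: subset_iff)
  then show "ennreal (dist (g (ts ! i)) (g (ts ! Suc i))) = ennreal (dist (h (ts ! i)) (h (ts ! Suc i)))"
    using assms by simp
qed

text \<open>Superadditivity of the length under concatenation, in the special case where the second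
  piece is measured by its chord; appending the chord to an inscribed polygon of the first piece
  gives an inscribed polygon of the whole. For line segments the chord is the full length, so this
  is what extending a polygon by one side requires.\<close>

lemma curve_length_append_chord:
  assumes "a \<le> b" "b \<le> c"
  shows "curve_length g a b + ennreal (dist (g b) (g c)) \<le> curve_length g a c"
proof -
  let ?S = "\<lambda>ts. \<Sum>i<length ts - 1. ennreal (dist (g (ts ! i)) (g (ts ! Suc i)))"
  have "curve_length g a b + ennreal (dist (g b) (g c)) =
      (SUP ts \<in> {ts. sorted ts \<and> set ts \<subseteq> {a..b}}. ?S ts + ennreal (dist (g b) (g c)))"
    unfolding curve_length_def
    by (rule ennreal_SUP_add_left[symmetric]) (auto intro!: exI[of _ "[]"])
  also have "\<dots> \<le> curve_length g a c"
  proof (rule SUP_least)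
    fix ts :: "real list" assume "ts \<in> {ts. sorted ts \<and> set ts \<subseteq> {a..b}}"
    then have ts: "sorted ts" "set ts \<subseteq> {a..b}" by auto
    define us where "us = ts @ [b, c]"
    have us: "sorted us" "set us \<subseteq> {a..c}"
      using ts assms by (auto simp: us_def sorted_append)
    have "?S ts \<le> (\<Sum>i<length ts. ennreal (dist (g (us ! i)) (g (us ! Suc i))))"
    proof -
      have "?S ts = (\<Sum>i<length ts - 1. ennreal (dist (g (us ! i)) (g (us ! Suc i))))"
        by (rule sum.cong) (auto simp: us_def nth_append)
      also have "\<dots> \<le> (\<Sum>i<length ts. ennreal (dist (g (us ! i)) (g (us ! Suc i))))"
        by (rule sum_mono2) auto
      finally show ?thesis .
    qed
    moreover have "?S us = (\<Sum>i<length ts. ennreal (dist (g (us ! i)) (g (us ! Suc i))))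
        + ennreal (dist (g b) (g c))"
      by (simp add: us_def nth_append)
    ultimately have "?S ts + ennreal (dist (g b) (g c)) \<le> ?S us"
      by (simp add: add_right_mono)
    also have "\<dots> \<le> curve_length g a c"
      unfolding curve_length_def using us by (intro SUP_upper) auto
    finally show "?S ts + ennreal (dist (g b) (g c)) \<le> curve_length g a c" .
  qed
  finally show ?thesis .
qed

section \<open>Unit-speed polygons\<close>

text \<open>The length condition asks only for the lower bound; the Lipschitz condition supplies the
  upper one. Only points of \<open>{0..L}\<close> matter, so that curves can be extended beyond \<open>L\<close>.\<close>

definition unit_speed :: "(real \<Rightarrow> real^2) \<Rightarrow> real \<Rightarrow> bool" where
  "unit_speed \<gamma> L \<longleftrightarrow> 0 \<le> L \<and>
     (\<forall>u\<in>{0..L}. \<forall>v\<in>{0..L}. dist (\<gamma> u) (\<gamma> v) \<le> \<bar>u - v\<bar>) \<and>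
     (\<forall>u\<in>{0..L}. ennreal u \<le> curve_length \<gamma> 0 u)"

text \<open>Rescaling a unit-speed curve to the parameter interval \<open>{0..1}\<close> makes its length function
  \<open>t \<mapsto> L * t\<close>. This is injective, so the choice in the definition of the arc-length
  parametrization is forced and returns the original curve.\<close>

lemma line_integral_unit_speed:
  assumes us: "unit_speed \<gamma> L" and L: "L > 0"
  defines "g \<equiv> \<lambda>t. \<gamma> (L * t)"
  shows "rectifiable_path g" and "line_integral \<sigma> g = (\<integral>\<^sup>+u\<in>{0..L}. \<sigma> (\<gamma> u) \<partial>lborel)"
proof -
  have scale: "curve_length \<gamma> 0 (L * t) \<le> curve_length g 0 t" for t
    unfolding curve_length_def
  proof (rule SUP_mono)
    fix ts assume "ts \<in> {ts. sorted ts \<and> set ts \<subseteq> {0..L * t}}"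
    then have "sorted (map (\<lambda>u. u / L) ts)" "set (map (\<lambda>u. u / L) ts) \<subseteq> {0..t}"
      using L by (auto simp: sorted_iff_nth_mono divide_right_mono field_simps subset_iff)
    moreover have "(\<Sum>i<length ts - 1. ennreal (dist (\<gamma> (ts ! i)) (\<gamma> (ts ! Suc i))))
        \<le> (\<Sum>i<length (map (\<lambda>u. u / L) ts) - 1.
          ennreal (dist (g (map (\<lambda>u. u / L) ts ! i)) (g (map (\<lambda>u. u / L) ts ! Suc i))))"
      using L by (auto intro!: sum_mono simp: g_def)
    ultimately show "\<exists>us\<in>{ts. sorted ts \<and> set ts \<subseteq> {0..t}}.
        (\<Sum>i<length ts - 1. ennreal (dist (\<gamma> (ts ! i)) (\<gamma> (ts ! Suc i))))
        \<le> (\<Sum>i<length us - 1. ennreal (dist (g (us ! i)) (g (us ! Suc i))))"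
      by blast
  qed
  have lip: "dist (g s) (g t) \<le> L * \<bar>s - t\<bar>" if "s \<in> {0..1}" "t \<in> {0..1}" for s t
  proof -
    have "dist (\<gamma> (L * s)) (\<gamma> (L * t)) \<le> \<bar>L * s - L * t\<bar>"
      using us that L by (auto simp: unit_speed_def mult_left_le)
    also have "\<dots> = L * \<bar>s - t\<bar>" using L by (simp add: abs_mult flip: right_diff_distrib)
    finally show ?thesis by (simp add: g_def)
  qed
  have len: "curve_length g 0 t = ennreal (L * t)" if "t \<in> {0..1}" for t
  proof (rule antisym)
    show "curve_length g 0 t \<le> ennreal (L * t)"
      using curve_length_Lipschitz_le[of 0 t L g] lip that L by auto
    have "L * t \<in> {0..L}" using that L by (auto simp: mult_left_le)
    then have "ennreal (L * t) \<le> curve_length \<gamma> 0 (L * t)"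
      using us by (simp add: unit_speed_def)
    then show "ennreal (L * t) \<le> curve_length g 0 t" using scale[of t] by simp
  qed
  have "L-lipschitz_on {0..1} g"
    using lip L by (intro lipschitz_onI) (auto simp: dist_real_def)
  then have "path g"
    unfolding path_def by (rule lipschitz_on_continuous_on)
  then show "rectifiable_path g"
    by (simp add: rectifiable_path_def len)
  have arc: "arc_length_param g u = \<gamma> u" if "u \<in> {0..L}" for u
  proof -
    have "(SOME t. t \<in> {0..1} \<and> curve_length g 0 t = ennreal u) = u / L"
    proof (rule some_equality)
      show "u / L \<in> {0..1} \<and> curve_length g 0 (u / L) = ennreal u"
        using that L by (auto simp: len)
      fix t assume t: "t \<in> {0..1} \<and> curve_length g 0 t = ennreal u"
      then have "ennreal (L * t) = ennreal u" using len[of t] by simp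
      then have "L * t = u" using t that L by (subst (asm) ennreal_inj) auto
      then show "t = u / L" using L by (simp add: field_simps)
    qed
    then show ?thesis using L by (simp add: arc_length_param_def g_def)
  qed
  have "line_integral \<sigma> g = (\<integral>\<^sup>+u\<in>{0..L}. \<sigma> (arc_length_param g u) \<partial>lborel)"
    using L by (simp add: line_integral_def len)
  also have "\<dots> = (\<integral>\<^sup>+u\<in>{0..L}. \<sigma> (\<gamma> u) \<partial>lborel)"
    by (intro nn_integral_cong) (auto simp: arc indicator_def)
  finally show "line_integral \<sigma> g = (\<integral>\<^sup>+u\<in>{0..L}. \<sigma> (\<gamma> u) \<partial>lborel)" .
qed

definition seg_integral :: "(real^2 \<Rightarrow> ennreal) \<Rightarrow> real^2 \<Rightarrow> real^2 \<Rightarrow> ennreal" where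
  "seg_integral \<sigma> p q = ennreal (dist p q) * (\<integral>\<^sup>+t\<in>{0..1}. \<sigma> (p + t *\<^sub>R (q - p)) \<partial>lborel)"

text \<open>The inductive step in the construction of polygons: run along the given curve and then with
  unit speed along the segment to \<open>q\<close>. The fourth property locates the new part without its
  endpoints, because a polygon that ends on the frontier of a domain has to stay inside until the
  last moment. If \<open>q\<close> is already the endpoint, nothing is added.\<close>

lemma unit_speed_extend:
  fixes \<gamma> :: "real \<Rightarrow> real^2"
  assumes us: "unit_speed \<gamma> L" and [measurable]: "\<sigma> \<in> borel_measurable borel"
  obtains \<gamma>' where "unit_speed \<gamma>' (L + dist (\<gamma> L) q)" "\<gamma>' (L + dist (\<gamma> L) q) = q"
    "\<And>u. u \<le> L \<Longrightarrow> \<gamma>' u = \<gamma> u"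
    "\<And>u. L < u \<Longrightarrow> u < L + dist (\<gamma> L) q \<Longrightarrow> \<exists>t\<in>{0<..<1}. \<gamma>' u = \<gamma> L + t *\<^sub>R (q - \<gamma> L)"
    "(\<integral>\<^sup>+u\<in>{0..L + dist (\<gamma> L) q}. \<sigma> (\<gamma>' u) \<partial>lborel)
       \<le> (\<integral>\<^sup>+u\<in>{0..L}. \<sigma> (\<gamma> u) \<partial>lborel) + seg_integral \<sigma> (\<gamma> L) q"
proof (cases "q = \<gamma> L")
  case True
  then show ?thesis using us that[of \<gamma>] by simp
next
  case False
  define p where "p = \<gamma> L"
  define d where "d = dist p q"
  define e where "e = (1 / d) *\<^sub>R (q - p)"
  define \<gamma>' where "\<gamma>' u = (if u \<le> L then \<gamma> u else p + (u - L) *\<^sub>R e)" for u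
  have d: "d > 0" using False by (simp add: d_def p_def)
  have e: "norm e = 1" using d by (simp add: e_def d_def dist_norm norm_minus_commute)
  have L: "0 \<le> L" using us by (simp add: unit_speed_def)
  have lip_\<gamma>: "dist (\<gamma> u) (\<gamma> v) \<le> \<bar>u - v\<bar>" if "u \<in> {0..L}" "v \<in> {0..L}" for u v
    using us that by (simp add: unit_speed_def)
  have after: "\<gamma>' u = p + (u - L) *\<^sub>R e" if "L \<le> u" for u
    using that by (auto simp: \<gamma>'_def p_def)
  have lip_after: "dist (\<gamma>' u) (\<gamma>' v) = \<bar>u - v\<bar>" if "L \<le> u" "L \<le> v" for u v
    using that e by (simp add: after dist_norm flip: scaleR_diff_left)
  have lip: "dist (\<gamma>' u) (\<gamma>' v) \<le> \<bar>u - v\<bar>" if "0 \<le> u" "u \<le> v" for u v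
  proof -
    consider "v \<le> L" | "L \<le> u" | "u \<le> L" "L \<le> v" by linarith
    then show ?thesis
    proof cases
      case 1
      then show ?thesis using that lip_\<gamma>[of u v] by (simp add: \<gamma>'_def)
    next
      case 2
      then show ?thesis using lip_after that by simp
    next
      case 3
      have "dist (\<gamma>' u) (\<gamma>' L) \<le> \<bar>u - L\<bar>"
        using lip_\<gamma>[of u L] that 3 L by (simp add: \<gamma>'_def)
      then show ?thesis
        using dist_triangle[of "\<gamma>' u" "\<gamma>' v" "\<gamma>' L"] lip_after[of L v] 3 by simp
    qed
  qed
  have len: "ennreal u \<le> curve_length \<gamma>' 0 u" if "0 \<le> u" for u
  proof (cases "u \<le> L")
    case True
    then have "curve_length \<gamma>' 0 u = curve_length \<gamma> 0 u"
      by (intro curve_length_cong) (auto simp: \<gamma>'_def)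
    then show ?thesis using us that True by (simp add: unit_speed_def)
  next
    case False
    have "ennreal u = ennreal L + ennreal (dist (\<gamma>' L) (\<gamma>' u))"
      using False L lip_after[of L u] by (simp flip: ennreal_plus)
    also have "\<dots> \<le> curve_length \<gamma>' 0 L + ennreal (dist (\<gamma>' L) (\<gamma>' u))"
    proof (rule add_right_mono)
      have "curve_length \<gamma>' 0 L = curve_length \<gamma> 0 L"
        by (intro curve_length_cong) (auto simp: \<gamma>'_def)
      then show "ennreal L \<le> curve_length \<gamma>' 0 L" using us L by (simp add: unit_speed_def)
    qed
    also have "\<dots> \<le> curve_length \<gamma>' 0 u"
      using L False by (intro curve_length_append_chord) auto
    finally show ?thesis .
  qed
  show ?thesis
  proof (rule that[of \<gamma>'], fold p_def, fold d_def)
    show "unit_speed \<gamma>' (L + d)"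
      unfolding unit_speed_def using L d len lip
      by (auto, metis abs_minus_commute dist_commute linear)
    show "\<gamma>' (L + d) = q" using d after[of "L + d"] by (simp add: e_def)
    show "\<gamma>' u = \<gamma> u" if "u \<le> L" for u using that by (simp add: \<gamma>'_def)
    show "\<exists>t\<in>{0<..<1}. \<gamma>' u = p + t *\<^sub>R (q - p)" if "L < u" "u < L + d" for u
      using that d by (intro bexI[of _ "(u - L) / d"]) (auto simp: after e_def)
    have seg: "seg_integral \<sigma> p q = (\<integral>\<^sup>+u\<in>{L..L + d}. \<sigma> (p + (u - L) *\<^sub>R e) \<partial>lborel)"
    proof -
      have "(\<integral>\<^sup>+u\<in>{L..L + d}. \<sigma> (p + (u - L) *\<^sub>R e) \<partial>lborel)
          = ennreal \<bar>d\<bar> * (\<integral>\<^sup>+t. \<sigma> (p + (L + d * t - L) *\<^sub>R e) * indicator {L..L + d} (L + d * t) \<partial>lborel)"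
        using d by (intro nn_integral_real_affine) auto
      also have "(\<integral>\<^sup>+t. \<sigma> (p + (L + d * t - L) *\<^sub>R e) * indicator {L..L + d} (L + d * t) \<partial>lborel)
          = (\<integral>\<^sup>+t\<in>{0..1}. \<sigma> (p + t *\<^sub>R (q - p)) \<partial>lborel)"
        using d by (intro nn_integral_cong) (auto simp: e_def indicator_def zero_le_mult_iff)
      finally show ?thesis using d by (simp add: seg_integral_def d_def)
    qed
    have cont: "continuous_on {0..L} \<gamma>"
      using us unfolding unit_speed_def continuous_on_iff
      by (metis dist_commute dist_real_def le_less_trans)
    \<comment> \<open>Outside \<open>{0..L}\<close> the curve is arbitrary, so it is cut off before composing with \<open>\<sigma>\<close>.\<close>
    have [measurable]: "(\<lambda>u. \<sigma> (\<gamma> u) * indicator {0..L} u) \<in> borel_measurable lborel"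
    proof -
      have [measurable]: "(\<lambda>u. indicator {0..L} u *\<^sub>R \<gamma> u) \<in> borel_measurable borel"
        using cont by (intro borel_measurable_continuous_on_indicator) auto
      have "(\<lambda>u. \<sigma> (\<gamma> u) * indicator {0..L} u)
          = (\<lambda>u. \<sigma> (indicator {0..L} u *\<^sub>R \<gamma> u) * indicator {0..L} u)"
        by (auto simp: indicator_def)
      then show ?thesis by simp
    qed
    have "(\<integral>\<^sup>+u\<in>{0..L + d}. \<sigma> (\<gamma>' u) \<partial>lborel)
        \<le> (\<integral>\<^sup>+u. \<sigma> (\<gamma> u) * indicator {0..L} u
              + \<sigma> (p + (u - L) *\<^sub>R e) * indicator {L..L + d} u \<partial>lborel)"
      by (intro nn_integral_mono) (auto simp: \<gamma>'_def indicator_def)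
    also have "\<dots> = (\<integral>\<^sup>+u\<in>{0..L}. \<sigma> (\<gamma> u) \<partial>lborel) + seg_integral \<sigma> p q"
      unfolding seg by (subst nn_integral_add) auto
    finally show "(\<integral>\<^sup>+u\<in>{0..L + d}. \<sigma> (\<gamma>' u) \<partial>lborel)
        \<le> (\<integral>\<^sup>+u\<in>{0..L}. \<sigma> (\<gamma> u) \<partial>lborel) + seg_integral \<sigma> p q" .
  qed
qed

section \<open>Polygons from a continuum to the boundary\<close>

text \<open>The predicate hides the parametrization of a polygon and keeps its endpoints, its range and
  an upper bound \<open>c\<close> for the integral of \<open>\<sigma>\<close>, so that polygons can be built side by side.\<close>

definition connectable :: "(real^2) set \<Rightarrow> (real^2 \<Rightarrow> ennreal) \<Rightarrow> real^2 \<Rightarrow> real^2 \<Rightarrow> ennreal \<Rightarrow> bool" where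
  "connectable G \<sigma> k p c \<longleftrightarrow> (\<exists>\<gamma> L. unit_speed \<gamma> L \<and> \<gamma> 0 = k \<and> \<gamma> L = p \<and> \<gamma> ` {0..L} \<subseteq> G \<and>
     (\<integral>\<^sup>+u\<in>{0..L}. \<sigma> (\<gamma> u) \<partial>lborel) \<le> c)"

lemma connectable_refl:
  assumes "k \<in> G"
  shows "connectable G \<sigma> k k 0"
proof -
  have "(\<integral>\<^sup>+u\<in>{0..0::real}. \<sigma> k \<partial>lborel) = 0"
    by (simp add: nn_integral_cmult_indicator)
  then show ?thesis
    unfolding connectable_def unit_speed_def using assms
    by (intro exI[of _ "\<lambda>_. k"] exI[of _ 0]) auto
qed

lemma connectable_step:
  assumes "connectable G \<sigma> k p c" and [measurable]: "\<sigma> \<in> borel_measurable borel"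
    and G: "closed_segment p q \<subseteq> G" and c: "seg_integral \<sigma> p q \<le> c'"
  shows "connectable G \<sigma> k q (c + c')"
proof -
  obtain \<gamma> L where \<gamma>: "unit_speed \<gamma> L" "\<gamma> 0 = k" "\<gamma> L = p" "\<gamma> ` {0..L} \<subseteq> G"
    "(\<integral>\<^sup>+u\<in>{0..L}. \<sigma> (\<gamma> u) \<partial>lborel) \<le> c"
    using assms(1) unfolding connectable_def by blast
  obtain \<gamma>' where \<gamma>': "unit_speed \<gamma>' (L + dist p q)" "\<gamma>' (L + dist p q) = q"
    "\<And>u. u \<le> L \<Longrightarrow> \<gamma>' u = \<gamma> u"
    "\<And>u. L < u \<Longrightarrow> u < L + dist p q \<Longrightarrow> \<exists>t\<in>{0<..<1}. \<gamma>' u = p + t *\<^sub>R (q - p)"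
    "(\<integral>\<^sup>+u\<in>{0..L + dist p q}. \<sigma> (\<gamma>' u) \<partial>lborel)
       \<le> (\<integral>\<^sup>+u\<in>{0..L}. \<sigma> (\<gamma> u) \<partial>lborel) + seg_integral \<sigma> p q"
    using unit_speed_extend[OF \<gamma>(1) assms(2), of q] \<gamma>(3) by auto
  have L: "0 \<le> L" using \<gamma>(1) by (simp add: unit_speed_def)
  have "\<gamma>' u \<in> G" if u: "u \<in> {0..L + dist p q}" for u
  proof -
    consider "u \<le> L" | "u = L + dist p q" | "L < u" "u < L + dist p q" using u by fastforce
    then show ?thesis
    proof cases
      case 1
      then show ?thesis using \<gamma>(4) \<gamma>'(3) u by auto
    next
      case 2
      then show ?thesis using \<gamma>'(2) G by auto
    next
      case 3
      then obtain t where t: "t \<in> {0<..<1}" "\<gamma>' u = p + t *\<^sub>R (q - p)" using \<gamma>'(4) by blast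
      then have "\<gamma>' u \<in> closed_segment p q"
        unfolding closed_segment_def by (auto intro!: exI[of _ t] simp: algebra_simps)
      then show ?thesis using G by auto
    qed
  qed
  moreover have "(\<integral>\<^sup>+u\<in>{0..L + dist p q}. \<sigma> (\<gamma>' u) \<partial>lborel) \<le> c + c'"
    using \<gamma>'(5) \<gamma>(5) c by (meson add_mono order_trans)
  ultimately show ?thesis
    unfolding connectable_def using \<gamma>' \<gamma> L by (intro exI[of _ \<gamma>'] exI[of _ "L + dist p q"]) auto
qed

lemma connectable_mono: "connectable G \<sigma> k p c \<Longrightarrow> c \<le> c' \<Longrightarrow> connectable G \<sigma> k p c'"
  unfolding connectable_def by (elim exE conjE, intro exI conjI) (assumption | rule order_trans)+

text \<open>Admissibility speaks about curves from \<open>K\<close> to the frontier. The last side of the polygon is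
  treated separately from the others, which run inside \<open>G\<close> up to both endpoints. As
  \<open>p \<noteq> q\<close>, the polygon has positive length and can be rescaled.\<close>

lemma admissible_connectable_to_frontier:
  assumes \<sigma>: "\<sigma> \<in> admissible (joining_curves K (frontier G) G)"
    and con: "connectable G \<sigma> k p c" and k: "k \<in> K"
    and q: "q \<in> frontier G" "p \<noteq> q" "open_segment p q \<subseteq> G"
    and c: "seg_integral \<sigma> p q \<le> c'"
  shows "1 \<le> c + c'"
proof -
  have [measurable]: "\<sigma> \<in> borel_measurable borel" using \<sigma> by (simp add: admissible_def)
  obtain \<gamma> L where \<gamma>: "unit_speed \<gamma> L" "\<gamma> 0 = k" "\<gamma> L = p" "\<gamma> ` {0..L} \<subseteq> G"
    "(\<integral>\<^sup>+u\<in>{0..L}. \<sigma> (\<gamma> u) \<partial>lborel) \<le> c"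
    using con unfolding connectable_def by blast
  obtain \<gamma>' where \<gamma>': "unit_speed \<gamma>' (L + dist p q)" "\<gamma>' (L + dist p q) = q"
    "\<And>u. u \<le> L \<Longrightarrow> \<gamma>' u = \<gamma> u"
    "\<And>u. L < u \<Longrightarrow> u < L + dist p q \<Longrightarrow> \<exists>t\<in>{0<..<1}. \<gamma>' u = p + t *\<^sub>R (q - p)"
    "(\<integral>\<^sup>+u\<in>{0..L + dist p q}. \<sigma> (\<gamma>' u) \<partial>lborel)
       \<le> (\<integral>\<^sup>+u\<in>{0..L}. \<sigma> (\<gamma> u) \<partial>lborel) + seg_integral \<sigma> p q"
    using unit_speed_extend[OF \<gamma>(1), of \<sigma> q] \<gamma>(3) by auto
  define M where "M = L + dist p q"
  have L: "0 \<le> L" using \<gamma>(1) by (simp add: unit_speed_def)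
  have M: "M > 0" using q(2) L by (simp add: M_def add_nonneg_pos)
  have "\<gamma>' u \<in> G" if u: "0 \<le> u" "u < M" for u
  proof (cases "u \<le> L")
    case True
    then show ?thesis using \<gamma>(4) \<gamma>'(3) u by auto
  next
    case False
    then obtain t where t: "t \<in> {0<..<1}" "\<gamma>' u = p + t *\<^sub>R (q - p)"
      using \<gamma>'(4)[of u] u by (auto simp: M_def)
    then have "\<gamma>' u \<in> open_segment p q"
      unfolding in_segment using q(2) by (auto intro!: exI[of _ t] simp: algebra_simps)
    then show ?thesis using q by auto
  qed
  then have "(\<lambda>t. \<gamma>' (M * t)) \<in> joining_curves K (frontier G) G"
    unfolding joining_curves_def
    using line_integral_unit_speed(1)[OF \<gamma>'(1)[folded M_def] M] \<gamma>'(2,3) \<gamma>(2) k q L M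
    by (auto simp: rectifiable_path_def pathstart_def pathfinish_def M_def[symmetric])
  then have "1 \<le> line_integral \<sigma> (\<lambda>t. \<gamma>' (M * t))"
    using \<sigma> line_integral_unit_speed(1)[OF \<gamma>'(1)[folded M_def] M] by (auto simp: admissible_def)
  also have "\<dots> = (\<integral>\<^sup>+u\<in>{0..M}. \<sigma> (\<gamma>' u) \<partial>lborel)"
    by (rule line_integral_unit_speed(2)[OF \<gamma>'(1)[folded M_def] M])
  also have "\<dots> \<le> c + c'"
    using \<gamma>'(5) \<gamma>(5) c unfolding M_def by (meson add_mono order_trans)
  finally show ?thesis .
qed

lemma norm_vector2: "norm (vector [a, b] :: real^2) = sqrt (a\<^sup>2 + b\<^sup>2)"
  by (simp add: norm_vec_def L2_set_def sum_2)

text \<open>A segment of unknown position on a known line is replaced by a fixed part of that line. This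
  removes the dependence on the position of the continuum before averaging.\<close>

lemma seg_integral_collinear_le:
  assumes [measurable]: "\<sigma> \<in> borel_measurable borel" and "{a..b} \<subseteq> I" "{b..a} \<subseteq> I" "I \<in> sets borel"
  shows "seg_integral \<sigma> (p + a *\<^sub>R v) (p + b *\<^sub>R v) \<le> ennreal (norm v) * (\<integral>\<^sup>+t\<in>I. \<sigma> (p + t *\<^sub>R v) \<partial>lborel)"
proof (cases "a = b")
  case True
  then show ?thesis by (simp add: seg_integral_def)
next
  case False
  note [measurable] = assms(4)
  have mem: "a + (b - a) * t \<in> I" if "t \<in> {0..1}" for t
  proof (cases "a \<le> b")
    case True
    then have "a + (b - a) * t \<in> {a..b}"
      using that mult_left_mono[of t 1 "b - a"] by auto
    then show ?thesis using assms by auto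
  next
    case False
    then have "a + (b - a) * t \<in> {b..a}"
      using that mult_left_mono[of t 1 "a - b"] mult_nonneg_nonneg[of t "a - b"]
      by (auto simp: algebra_simps)
    then show ?thesis using assms by auto
  qed
  have "dist (p + a *\<^sub>R v) (p + b *\<^sub>R v) = norm v * \<bar>b - a\<bar>"
    by (simp add: dist_norm abs_minus_commute flip: scaleR_diff_left)
  then have "seg_integral \<sigma> (p + a *\<^sub>R v) (p + b *\<^sub>R v)
      = ennreal (norm v) * (ennreal \<bar>b - a\<bar> *
          (\<integral>\<^sup>+t\<in>{0..1}. \<sigma> (p + (a + (b - a) * t) *\<^sub>R v) \<partial>lborel))"
    by (simp add: seg_integral_def ennreal_mult mult.assoc) (simp add: algebra_simps abs_minus_commute)
  also have "\<dots> \<le> ennreal (norm v) * (ennreal \<bar>b - a\<bar> *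
          (\<integral>\<^sup>+t. \<sigma> (p + (a + (b - a) * t) *\<^sub>R v) * indicator I (a + (b - a) * t) \<partial>lborel))"
    using mem by (intro mult_left_mono nn_integral_mono) (auto simp: indicator_def)
  also have "\<dots> = ennreal (norm v) * (\<integral>\<^sup>+t\<in>I. \<sigma> (p + t *\<^sub>R v) \<partial>lborel)"
    using False
    by (subst nn_integral_real_affine[where c = "b - a" and t = a and f = "\<lambda>t. \<sigma> (p + t *\<^sub>R v) * indicator I t"]) auto
  finally show ?thesis .
qed

lemma seg_integral_horizontal_le:
  assumes "\<sigma> \<in> borel_measurable borel" "a \<in> {-R..R}" "a' \<in> {-R..R}"
  shows "seg_integral \<sigma> (x0 + vector [a, b]) (x0 + vector [a', b])
    \<le> (\<integral>\<^sup>+u\<in>{-R..R}. \<sigma> (x0 + vector [u, b]) \<partial>lborel)"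
proof -
  have eq: "x0 + vector [u, b] = (x0 + vector [0, b]) + u *\<^sub>R vector [1, 0]" for u :: real
    by (simp add: vec_eq_iff forall_2)
  have "seg_integral \<sigma> ((x0 + vector [0, b]) + a *\<^sub>R vector [1, 0]) ((x0 + vector [0, b]) + a' *\<^sub>R vector [1, 0])
    \<le> ennreal (norm (vector [1, 0] :: real^2)) * (\<integral>\<^sup>+u\<in>{-R..R}. \<sigma> ((x0 + vector [0, b]) + u *\<^sub>R vector [1, 0]) \<partial>lborel)"
    using assms by (intro seg_integral_collinear_le) auto
  then show ?thesis unfolding eq[symmetric] by (simp add: norm_vector2)
qed

lemma seg_integral_vertical_le:
  assumes "\<sigma> \<in> borel_measurable borel" "b \<in> {-R..R}" "b' \<in> {-R..R}"
  shows "seg_integral \<sigma> (x0 + vector [a, b]) (x0 + vector [a, b'])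
    \<le> (\<integral>\<^sup>+u\<in>{-R..R}. \<sigma> (x0 + vector [a, u]) \<partial>lborel)"
proof -
  have eq: "x0 + vector [a, u] = (x0 + vector [a, 0]) + u *\<^sub>R vector [0, 1]" for u :: real
    by (simp add: vec_eq_iff forall_2)
  have "seg_integral \<sigma> ((x0 + vector [a, 0]) + b *\<^sub>R vector [0, 1]) ((x0 + vector [a, 0]) + b' *\<^sub>R vector [0, 1])
    \<le> ennreal (norm (vector [0, 1] :: real^2)) * (\<integral>\<^sup>+u\<in>{-R..R}. \<sigma> ((x0 + vector [a, 0]) + u *\<^sub>R vector [0, 1]) \<partial>lborel)"
    using assms by (intro seg_integral_collinear_le) auto
  then show ?thesis unfolding eq[symmetric] by (simp add: norm_vector2)
qed

text \<open>The distance from \<open>x0\<close> in the maximum norm maps \<open>K\<close> to a connected set of reals containing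
  \<open>0\<close> and \<open>R\<close>.\<close>

lemma connected_meets_square:
  fixes K :: "(real^2) set"
  assumes K: "connected K" "x0 \<in> K" "x0 + vector [R, 0] \<in> K" and s: "0 \<le> s" "s \<le> R"
  obtains a b where "x0 + vector [a, b] \<in> K" "max \<bar>a\<bar> \<bar>b\<bar> = s"
proof -
  define N where "N z = max \<bar>z$1 - x0$1\<bar> \<bar>z$2 - x0$2\<bar>" for z :: "real^2"
  have "connected (N ` K)"
    unfolding N_def by (intro connected_continuous_image K continuous_intros)
  moreover have "0 \<in> N ` K" using K(2) by (force simp: N_def)
  moreover have "R \<in> N ` K"
    using K(3) s by (intro image_eqI[of _ _ "x0 + vector [R, 0]"]) (auto simp: N_def)
  ultimately have "s \<in> N ` K" using connected_contains_Icc[of "N ` K" 0 R] s by auto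
  then obtain k where k: "k \<in> K" "N k = s" by auto
  have "x0 + vector [k$1 - x0$1, k$2 - x0$2] = k"
    by (simp add: vec_eq_iff forall_2)
  then show ?thesis using that[of "k$1 - x0$1" "k$2 - x0$2"] k by (simp add: N_def)
qed

text \<open>From a point of the square with half-side \<open>s\<close> one reaches the point \<open>s * (m, -1)\<close> of the
  lower side along at most three lines. From a vertical side one descends to the corner below and
  turns. From a horizontal side one first walks to the right-hand side. The bound is the same
  for all positions; the lower side counts twice because a walk from the lower side passes it
  twice.\<close>

lemma connectable_along_square:
  assumes \<sigma>: "\<sigma> \<in> borel_measurable borel"
    and box: "\<And>a b. \<bar>a\<bar> \<le> s \<Longrightarrow> \<bar>b\<bar> \<le> s \<Longrightarrow> x0 + vector [a, b] \<in> U"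
    and U: "convex U" "U \<subseteq> G"
    and ab: "max \<bar>a\<bar> \<bar>b\<bar> = s" and s: "s \<le> R" and m: "m \<in> {0..1}"
  defines "H \<equiv> \<lambda>b. \<integral>\<^sup>+a\<in>{-R..R}. \<sigma> (x0 + vector [a, b]) \<partial>lborel"
    and "V \<equiv> \<lambda>a. \<integral>\<^sup>+b\<in>{-R..R}. \<sigma> (x0 + vector [a, b]) \<partial>lborel"
  shows "connectable G \<sigma> (x0 + vector [a, b]) (x0 + vector [s * m, - s]) (2 * H (-s) + H s + V s + V (-s))"
proof -
  have s0: "0 \<le> s" using ab by linarith
  have le: "\<bar>a\<bar> \<le> s" "\<bar>b\<bar> \<le> s" using ab by linarith+
  have sm: "0 \<le> s * m" "s * m \<le> s" using m s0 by (auto simp: mult_left_le)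
  have seg: "closed_segment (x0 + vector [c, d]) (x0 + vector [c', d']) \<subseteq> G"
    if "\<bar>c\<bar> \<le> s" "\<bar>d\<bar> \<le> s" "\<bar>c'\<bar> \<le> s" "\<bar>d'\<bar> \<le> s" for c d c' d'
    using closed_segment_subset[OF box box U(1)] U(2) that by blast
  have h: "seg_integral \<sigma> (x0 + vector [c, d]) (x0 + vector [c', d]) \<le> H d"
    if "\<bar>c\<bar> \<le> s" "\<bar>c'\<bar> \<le> s" for c c' d
    unfolding H_def using that s by (intro seg_integral_horizontal_le[OF \<sigma>]) auto
  have v: "seg_integral \<sigma> (x0 + vector [c, d]) (x0 + vector [c, d']) \<le> V c"
    if "\<bar>d\<bar> \<le> s" "\<bar>d'\<bar> \<le> s" for c d d'
    unfolding V_def using that s by (intro seg_integral_vertical_le[OF \<sigma>]) auto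
  have start: "connectable G \<sigma> (x0 + vector [a, b]) (x0 + vector [a, b]) 0"
    using box[OF le] U(2) by (intro connectable_refl) auto
  note step = connectable_step[OF _ \<sigma>]
  consider "\<bar>a\<bar> = s" | "\<bar>b\<bar> = s" using ab by linarith
  then show ?thesis
  proof cases
    case 1
    have "connectable G \<sigma> (x0 + vector [a, b]) (x0 + vector [s * m, - s]) (0 + V a + H (-s))"
      by (rule step[OF step[OF start, where q = "x0 + vector [a, -s]"]]; (rule seg h v)?)
        (use le s0 sm in auto)
    moreover have "0 + V a + H (-s) \<le> 2 * H (-s) + H s + V s + V (-s)"
    proof -
      have "V a \<le> V s + V (-s)" using 1 by (cases "a = s") (auto simp: abs_if split: if_splits)
      then have "V a + H (-s) \<le> (V s + V (-s)) + (H (-s) + (H (-s) + H s))"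
        by (rule add_mono) simp
      then show ?thesis by (simp only: mult_2 mult_2_right add_0_left ac_simps)
    qed
    ultimately show ?thesis by (rule connectable_mono)
  next
    case 2
    have "connectable G \<sigma> (x0 + vector [a, b]) (x0 + vector [s * m, - s]) (0 + H b + V s + H (-s))"
      by (rule step[OF step[OF step[OF start, where q = "x0 + vector [s, b]"], where q = "x0 + vector [s, -s]"]]; (rule seg h v)?)
        (use le s0 sm in auto)
    moreover have "0 + H b + V s + H (-s) \<le> 2 * H (-s) + H s + V s + V (-s)"
    proof -
      have "H b \<le> H s + H (-s)" using 2 by (cases "b = s") (auto simp: abs_if split: if_splits)
      then have "H b + (V s + H (-s)) \<le> (H s + H (-s)) + (V s + H (-s) + V (-s))"
        by (rule add_mono) simp
      then show ?thesis by (simp only: mult_2 mult_2_right add_0_left ac_simps)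
    qed
    ultimately show ?thesis by (rule connectable_mono)
  qed
qed

text \<open>The exit time is attained because \<open>G\<close> is open, and the exit point lies on the frontier
  because it is a limit of points of \<open>G\<close>.\<close>

lemma first_exit:
  fixes G :: "(real^2) set"
  assumes G: "open G" and s: "s \<le> 1" "p + s *\<^sub>R v \<in> G" "p + v \<notin> G"
  obtains T where "s < T" "T \<le> 1" "p + T *\<^sub>R v \<in> frontier G"
    "open_segment (p + s *\<^sub>R v) (p + T *\<^sub>R v) \<subseteq> G" "p + s *\<^sub>R v \<noteq> p + T *\<^sub>R v"
proof -
  define E where "E = {s..1} \<inter> (\<lambda>t. p + t *\<^sub>R v) -` (- G)"
  have "closed E"
    unfolding E_def using G by (intro continuous_closed_preimage continuous_intros) auto
  then have "compact E"
    using bounded_subset[of "{s..1}" E] by (auto simp: compact_eq_bounded_closed E_def)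
  moreover have "1 \<in> E" using s by (auto simp: E_def)
  ultimately obtain T where T: "T \<in> E" "\<And>t. t \<in> E \<Longrightarrow> T \<le> t"
    using compact_attains_inf[of E] by auto
  have sT: "s < T" using T(1) s(2) by (cases "s = T") (auto simp: E_def)
  have before: "p + t *\<^sub>R v \<in> G" if "s \<le> t" "t < T" for t
    using T(1) T(2)[of t] that by (force simp: E_def)
  have out: "p + T *\<^sub>R v \<notin> G" using T(1) by (auto simp: E_def)
  then have ne: "p + s *\<^sub>R v \<noteq> p + T *\<^sub>R v" using s by metis
  have sub: "open_segment (p + s *\<^sub>R v) (p + T *\<^sub>R v) \<subseteq> G"
  proof
    fix z assume "z \<in> open_segment (p + s *\<^sub>R v) (p + T *\<^sub>R v)"
    then obtain u where u: "0 < u" "u < 1" "z = (1 - u) *\<^sub>R (p + s *\<^sub>R v) + u *\<^sub>R (p + T *\<^sub>R v)"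
      by (auto simp: in_segment)
    then have "z = p + (s + u * (T - s)) *\<^sub>R v" by (simp add: algebra_simps)
    moreover have "s + u * (T - s) < T"
    proof -
      have "u * (T - s) < 1 * (T - s)" using u sT by (intro mult_strict_right_mono) auto
      then have "u * (T - s) < T - s" by simp
      then show ?thesis by (simp only: less_diff_eq add.commute)
    qed
    moreover have "s \<le> s + u * (T - s)" using u sT by simp
    ultimately show "z \<in> G" using before by simp
  qed
  have "p + T *\<^sub>R v \<in> closure (open_segment (p + s *\<^sub>R v) (p + T *\<^sub>R v))"
    using ne by simp
  then have "p + T *\<^sub>R v \<in> frontier G"
    using out closure_mono[OF sub] interior_subset[of G] by (auto simp: frontier_def)
  then show ?thesis using that[of T] sT T(1) ne sub by (auto simp: E_def)
qed

section \<open>Averaging over squares and rays\<close>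

text \<open>The coordinate map from pairs to vectors, shifted by \<open>x0\<close>, preserves Lebesgue measure, since
  it does so on boxes. Hence Fubini's theorem applies to plane integrals in coordinates centred at
  \<open>x0\<close>.\<close>

lemma nn_integral_vec2:
  fixes f :: "real^2 \<Rightarrow> ennreal"
  assumes [measurable]: "f \<in> borel_measurable borel"
  shows "(\<integral>\<^sup>+x. f x \<partial>lborel) = (\<integral>\<^sup>+b. \<integral>\<^sup>+a. f (x0 + vector [a, b]) \<partial>lborel \<partial>lborel)"
proof -
  define T :: "real \<times> real \<Rightarrow> real^2" where "T z = x0 + vector [fst z, snd z]" for z
  have Tc: "T = (\<lambda>z. x0 + (fst z *\<^sub>R axis 1 1 + snd z *\<^sub>R axis 2 1))"
    by (auto simp: T_def fun_eq_iff vec_eq_iff forall_2 axis_def)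
  have [measurable]: "T \<in> borel_measurable borel"
    unfolding Tc by (intro borel_measurable_continuous_onI continuous_intros)
  then have [measurable]: "T \<in> borel_measurable (borel \<Otimes>\<^sub>M borel)"
    by (simp add: borel_prod)
  have "lborel = distr lborel borel T"
  proof (rule lborel_eqI)
    fix l u :: "real^2"
    assume le: "\<And>i. i \<in> Basis \<Longrightarrow> l \<bullet> i \<le> u \<bullet> i"
    have le12: "l $ 1 \<le> u $ 1" "l $ 2 \<le> u $ 2"
      using le[of "axis 1 1"] le[of "axis 2 1"] by (auto simp: inner_axis axis_in_Basis_iff)
    have pre: "T -` box l u = box (l$1 - x0$1, l$2 - x0$2) (u$1 - x0$1, u$2 - x0$2)"
      by (auto simp: T_def mem_box_cart forall_2 box_prod)
    have "emeasure (distr lborel borel T) (box l u) = emeasure lborel (T -` box l u)"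
      by (simp add: emeasure_distr)
    also have "\<dots> = ennreal ((u$1 - l$1) * (u$2 - l$2))"
      unfolding pre using le12
      by (subst emeasure_lborel_box) (auto simp: Basis_prod_def prod.union_disjoint)
    also have "(u$1 - l$1) * (u$2 - l$2) = (\<Prod>i\<in>Basis. (u - l) \<bullet> i)"
      by (simp add: Basis_vec_def UNIV_2 inner_axis axis_eq_axis)
    finally show "emeasure (distr lborel borel T) (box l u) = ennreal (\<Prod>i\<in>Basis. (u - l) \<bullet> i)" .
  qed simp
  then have "(\<integral>\<^sup>+x. f x \<partial>lborel) = (\<integral>\<^sup>+x. f x \<partial>distr lborel borel T)" by simp
  also have "\<dots> = (\<integral>\<^sup>+z. f (T z) \<partial>(lborel \<Otimes>\<^sub>M lborel))"
    by (subst nn_integral_distr) (auto simp: lborel_prod)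
  also have "\<dots> = (\<integral>\<^sup>+b. \<integral>\<^sup>+a. f (T (a, b)) \<partial>lborel \<partial>lborel)"
    by (subst lborel_pair.nn_integral_snd[symmetric]) (auto simp: borel_prod[symmetric] lborel_prod)
  finally show ?thesis by (simp add: T_def)
qed

text \<open>The weighted inequality between arithmetic and geometric mean, from which the Cauchy-Schwarz
  inequality follows by integration; it makes sense for infinite \<open>x\<close> as well, as values of
  admissible functions may be.\<close>

lemma ennreal_two_mult_le:
  fixes x :: ennreal
  assumes "M > 0" "0 \<le> w"
  shows "2 * (x * ennreal w) \<le> ennreal M * x\<^sup>2 + ennreal (w\<^sup>2 / M)"
proof (cases x)
  case (real u)
  have "0 \<le> (M * u - w)\<^sup>2 / M" using assms by simp
  also have "(M * u - w)\<^sup>2 / M = M * u\<^sup>2 + w\<^sup>2 / M - 2 * (u * w)"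
    using assms by (simp add: power2_eq_square field_simps)
  finally have "2 * (u * w) \<le> M * u\<^sup>2 + w\<^sup>2 / M" by simp
  then have "ennreal (2 * (u * w)) \<le> ennreal (M * u\<^sup>2 + w\<^sup>2 / M)"
    by (rule ennreal_leI)
  then show ?thesis
    using real assms by (simp add: ennreal_mult ennreal_power)
next
  case top
  then show ?thesis using assms by (simp add: ennreal_mult_top)
qed

lemma borel_measurable_indicator_Icc [measurable]:
  fixes f g h :: "'a \<Rightarrow> real"
  assumes [measurable]: "f \<in> borel_measurable M" "g \<in> borel_measurable M" "h \<in> borel_measurable M"
  shows "(\<lambda>x. indicator {f x..g x} (h x) :: real) \<in> borel_measurable M"
    and "(\<lambda>x. indicator {f x..g x} (h x) :: ennreal) \<in> borel_measurable M"
  unfolding indicator_def atLeastAtMost_iff of_bool_def by measurable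

text \<open>Here \<open>F\<close> stands for an admissible function in coordinates centred at \<open>x0\<close>, the term
  \<open>2 * H (-s) + H s + V s + V (-s)\<close> bounds its integral along the sides of the square of half-side
  \<open>s\<close>, and the last term in the assumption its integral along the ray of slope parameter \<open>m\<close>.
  Averaging over \<open>m\<close> turns the ray term into an integral over the cone, whose horizontal section at
  depth \<open>t\<close> has length \<open>t\<close>: the substitution \<open>a = t * m\<close> produces the weight \<open>1 / t\<close>. Averaging
  over \<open>s\<close> turns each of the five line integrals into at most \<open>1 / r\<close> times the integral over the
  square of half-side \<open>2 * r\<close>.\<close>

lemma averaged_box_cone_bound:
  fixes F :: "real \<times> real \<Rightarrow> ennreal"
  assumes F[measurable]: "F \<in> borel_measurable (borel \<Otimes>\<^sub>M borel)" and r: "0 < r" "r < 1"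
  defines "H \<equiv> \<lambda>b. \<integral>\<^sup>+a\<in>{-(2*r)..2*r}. F (a, b) \<partial>lborel"
    and "V \<equiv> \<lambda>a. \<integral>\<^sup>+b\<in>{-(2*r)..2*r}. F (a, b) \<partial>lborel"
  assumes bound: "\<And>s m. s \<in> {r..2*r} \<Longrightarrow> m \<in> {0..1} \<Longrightarrow>
     1 \<le> (2 * H (-s) + H s + V s + V (-s)) + 2 * (\<integral>\<^sup>+t\<in>{r..1}. F (t * m, - t) \<partial>lborel)"
  shows "1 \<le> (\<integral>\<^sup>+b. \<integral>\<^sup>+a. F (a, b) * ennreal
        (5 / r * (indicator {-(2*r)..2*r} a * indicator {-(2*r)..2*r} b) +
         2 / \<bar>b\<bar> * (indicator {0..-b} a * indicator {-1..-r} b)) \<partial>lborel \<partial>lborel)"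
proof -
  have [measurable]: "H \<in> borel_measurable borel" "V \<in> borel_measurable borel"
    unfolding H_def V_def by measurable
  define A where "A s = 2 * H (-s) + H s + V s + V (-s)" for s
  have [measurable]: "A \<in> borel_measurable borel"
    unfolding A_def by measurable
  define B where "B = (\<integral>\<^sup>+m\<in>{0..1}. \<integral>\<^sup>+t\<in>{r..1}. F (t * m, - t) \<partial>lborel \<partial>lborel)"
  define C where "C = (\<integral>\<^sup>+b. (\<integral>\<^sup>+a. F (a, b) * indicator {0..-b} a \<partial>lborel) * ennreal (1 / \<bar>b\<bar>) * indicator {-1..-r} b \<partial>lborel)"
  define Q where "Q = (\<integral>\<^sup>+b\<in>{-(2*r)..2*r}. H b \<partial>lborel)"
  have onem: "1 \<le> A s + 2 * B" if s: "s \<in> {r..2*r}" for s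
  proof -
    have "(1::ennreal) = (\<integral>\<^sup>+m\<in>{0..1::real}. 1 \<partial>lborel)" by simp
    also have "\<dots> \<le> (\<integral>\<^sup>+m. A s * indicator {0..1} m +
        2 * ((\<integral>\<^sup>+t\<in>{r..1}. F (t * m, - t) \<partial>lborel) * indicator {0..1} m) \<partial>lborel)"
      using bound[OF s] unfolding A_def by (intro nn_integral_mono) (auto simp: indicator_def)
    also have "\<dots> = A s + 2 * B"
      unfolding B_def by (subst nn_integral_add) (auto simp: nn_integral_cmult)
    finally show ?thesis .
  qed
  have "ennreal r = (\<integral>\<^sup>+s\<in>{r..2*r}. 1 \<partial>lborel)" using r by simp
  also have "\<dots> \<le> (\<integral>\<^sup>+s. A s * indicator {r..2*r} s + 2 * B * indicator {r..2*r} s \<partial>lborel)"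
    using onem by (intro nn_integral_mono) (auto simp: indicator_def)
  also have "\<dots> = (\<integral>\<^sup>+s\<in>{r..2*r}. A s \<partial>lborel) + 2 * B * ennreal r"
    using r by (subst nn_integral_add) (auto simp: nn_integral_cmult)
  finally have 1: "ennreal r \<le> (\<integral>\<^sup>+s\<in>{r..2*r}. A s \<partial>lborel) + 2 * B * ennreal r" .
  have pos: "(\<integral>\<^sup>+s\<in>{r..2*r}. f s \<partial>lborel) \<le> (\<integral>\<^sup>+b\<in>{-(2*r)..2*r}. f b \<partial>lborel)" for f
    using r by (intro nn_integral_mono) (auto simp: indicator_def)
  have neg: "(\<integral>\<^sup>+s\<in>{r..2*r}. f (-s) \<partial>lborel) \<le> (\<integral>\<^sup>+b\<in>{-(2*r)..2*r}. f b \<partial>lborel)"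
    if [measurable]: "f \<in> borel_measurable borel" for f
  proof -
    have "(\<integral>\<^sup>+b\<in>{-(2*r)..2*r}. f b \<partial>lborel)
       = (\<integral>\<^sup>+s. f (-s) * indicator {-(2*r)..2*r} (-s) \<partial>lborel)"
      using nn_integral_real_affine[of "\<lambda>b. f b * indicator {-(2*r)..2*r} b" "-1" 0] by simp
    also have "\<dots> \<ge> (\<integral>\<^sup>+s\<in>{r..2*r}. f (-s) \<partial>lborel)"
      using r by (intro nn_integral_mono) (auto simp: indicator_def)
    finally show ?thesis .
  qed
  have QV: "Q = (\<integral>\<^sup>+a\<in>{-(2*r)..2*r}. V a \<partial>lborel)"
  proof -
    have "Q = (\<integral>\<^sup>+b. \<integral>\<^sup>+a. F (a, b) * indicator {-(2*r)..2*r} a * indicator {-(2*r)..2*r} b \<partial>lborel \<partial>lborel)"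
      unfolding Q_def H_def by (simp add: nn_integral_multc)
    also have "\<dots> = (\<integral>\<^sup>+a. \<integral>\<^sup>+b. F (a, b) * indicator {-(2*r)..2*r} a * indicator {-(2*r)..2*r} b \<partial>lborel \<partial>lborel)"
      by (rule lborel_pair.Fubini') measurable
    also have "\<dots> = (\<integral>\<^sup>+a. \<integral>\<^sup>+b. F (a, b) * indicator {-(2*r)..2*r} b * indicator {-(2*r)..2*r} a \<partial>lborel \<partial>lborel)"
      by (simp add: ac_simps)
    also have "\<dots> = (\<integral>\<^sup>+a\<in>{-(2*r)..2*r}. V a \<partial>lborel)"
      unfolding V_def by (simp add: nn_integral_multc)
    finally show ?thesis .
  qed
  \<comment> \<open>The factor five counts the line integrals in \<open>A\<close>, each of which sweeps a part of the square.\<close>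
  have "(\<integral>\<^sup>+s\<in>{r..2*r}. A s \<partial>lborel) =
      2 * (\<integral>\<^sup>+s\<in>{r..2*r}. H (-s) \<partial>lborel) + (\<integral>\<^sup>+s\<in>{r..2*r}. H s \<partial>lborel)
      + (\<integral>\<^sup>+s\<in>{r..2*r}. V s \<partial>lborel) + (\<integral>\<^sup>+s\<in>{r..2*r}. V (-s) \<partial>lborel)"
    unfolding A_def by (simp add: distrib_right nn_integral_add nn_integral_cmult mult.assoc)
  also have "\<dots> \<le> 2 * Q + Q + Q + Q"
    using pos[of H] neg[of H] pos[of V] neg[of V]
    unfolding QV[symmetric] Q_def[symmetric]
    by (intro add_mono mult_left_mono) auto
  also have "\<dots> = (2 + 1 + 1 + 1) * Q" by (simp only: distrib_right mult_1)
  also have "\<dots> = 5 * Q" by simp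
  finally have 2: "(\<integral>\<^sup>+s\<in>{r..2*r}. A s \<partial>lborel) \<le> 5 * Q" .
  have 3: "B = C"
  proof -
    have "B = (\<integral>\<^sup>+m. \<integral>\<^sup>+t. F (t * m, - t) * indicator {r..1} t * indicator {0..1} m \<partial>lborel \<partial>lborel)"
      unfolding B_def by (simp add: nn_integral_multc)
    also have "\<dots> = (\<integral>\<^sup>+t. \<integral>\<^sup>+m. F (t * m, - t) * indicator {r..1} t * indicator {0..1} m \<partial>lborel \<partial>lborel)"
      by (rule lborel_pair.Fubini') measurable
    also have "\<dots> = (\<integral>\<^sup>+t. (\<integral>\<^sup>+a. F (a, - t) * indicator {0..t} a \<partial>lborel) * ennreal (1 / t) * indicator {r..1} t \<partial>lborel)"
    proof (rule nn_integral_cong)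
      fix t :: real
      show "(\<integral>\<^sup>+m. F (t * m, - t) * indicator {r..1} t * indicator {0..1} m \<partial>lborel)
        = (\<integral>\<^sup>+a. F (a, - t) * indicator {0..t} a \<partial>lborel) * ennreal (1 / t) * indicator {r..1} t"
      proof (cases "t \<in> {r..1}")
        case True
        then have t: "t > 0" using r by simp
        have "(\<integral>\<^sup>+a. F (a, - t) * indicator {0..t} a \<partial>lborel)
            = ennreal t * (\<integral>\<^sup>+m. F (t * m, - t) * indicator {0..t} (t * m) \<partial>lborel)"
          using t nn_integral_real_affine[of "\<lambda>a. F (a, - t) * indicator {0..t} a" t 0] by simp
        also have "(\<integral>\<^sup>+m. F (t * m, - t) * indicator {0..t} (t * m) \<partial>lborel)
           = (\<integral>\<^sup>+m. F (t * m, - t) * indicator {0..1} m \<partial>lborel)"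
          using t by (intro nn_integral_cong) (auto simp: indicator_def zero_le_mult_iff)
        finally have "(\<integral>\<^sup>+a. F (a, - t) * indicator {0..t} a \<partial>lborel) * ennreal (1 / t)
            = (\<integral>\<^sup>+m. F (t * m, - t) * indicator {0..1} m \<partial>lborel) * (ennreal t * ennreal (1 / t))"
          by (simp add: ac_simps)
        also have "ennreal t * ennreal (1 / t) = 1" using t by (simp flip: ennreal_mult)
        finally show ?thesis using True by simp
      qed simp
    qed
    also have "\<dots> = C"
      unfolding C_def
      by (subst nn_integral_real_affine[of "\<lambda>b. (\<integral>\<^sup>+a. F (a, b) * indicator {0..-b} a \<partial>lborel) * ennreal (1 / \<bar>b\<bar>) * indicator {-1..-r} b" "-1" 0])
        (use r in \<open>auto intro!: nn_integral_cong simp: indicator_def\<close>)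
    finally show ?thesis .
  qed
  have "ennreal r \<le> 5 * Q + 2 * C * ennreal r"
    using 1 2 unfolding 3 by (meson add_right_mono order_trans)
  then have "ennreal r * ennreal (1 / r) \<le> (5 * Q + 2 * C * ennreal r) * ennreal (1 / r)"
    by (rule mult_right_mono) simp
  moreover have rr: "ennreal r * ennreal (1 / r) = 1" using r by (simp flip: ennreal_mult)
  ultimately have "1 \<le> Q * ennreal (5 / r) + 2 * C"
  proof -
    have "(5 * Q + 2 * C * ennreal r) * ennreal (1 / r)
       = Q * (5 * ennreal (1 / r)) + 2 * C * (ennreal r * ennreal (1 / r))"
      by (simp add: algebra_simps)
    also have "5 * ennreal (1 / r) = ennreal (5 / r)"
      using r ennreal_mult[of 5 "1 / r"] by simp
    finally show ?thesis
      using \<open>ennreal r * ennreal (1 / r) \<le> _\<close> unfolding rr by simp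
  qed
  also have "\<dots> = (\<integral>\<^sup>+b. \<integral>\<^sup>+a. F (a, b) * ennreal (5 / r) * indicator {-(2*r)..2*r} a * indicator {-(2*r)..2*r} b
      + F (a, b) * ennreal (2 / \<bar>b\<bar>) * indicator {0..-b} a * indicator {-1..-r} b \<partial>lborel \<partial>lborel)"
  proof -
    have "(\<integral>\<^sup>+b. \<integral>\<^sup>+a. F (a, b) * ennreal (5 / r) * indicator {-(2*r)..2*r} a * indicator {-(2*r)..2*r} b \<partial>lborel \<partial>lborel)
        = (\<integral>\<^sup>+b. \<integral>\<^sup>+a. (F (a, b) * indicator {-(2*r)..2*r} a) * indicator {-(2*r)..2*r} b * ennreal (5 / r) \<partial>lborel \<partial>lborel)"
      by (simp only: ac_simps)
    also have "\<dots> = Q * ennreal (5 / r)"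
      unfolding Q_def H_def by (simp add: nn_integral_multc)
    finally have q: "(\<integral>\<^sup>+b. \<integral>\<^sup>+a. F (a, b) * ennreal (5 / r) * indicator {-(2*r)..2*r} a * indicator {-(2*r)..2*r} b \<partial>lborel \<partial>lborel)
        = Q * ennreal (5 / r)" .
    have two: "ennreal (2 / \<bar>b\<bar>) = 2 * ennreal (1 / \<bar>b\<bar>)" for b :: real
      using ennreal_mult[of 2 "1 / \<bar>b\<bar>"] by simp
    have "(\<integral>\<^sup>+b. \<integral>\<^sup>+a. F (a, b) * ennreal (2 / \<bar>b\<bar>) * indicator {0..-b} a * indicator {-1..-r} b \<partial>lborel \<partial>lborel)
        = (\<integral>\<^sup>+b. \<integral>\<^sup>+a. F (a, b) * indicator {0..-b} a * ennreal (1 / \<bar>b\<bar>) * indicator {-1..-r} b * 2 \<partial>lborel \<partial>lborel)"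
      unfolding two by (simp only: ac_simps)
    also have "\<dots> = C * 2"
      unfolding C_def by (simp add: nn_integral_multc)
    finally show ?thesis
      using q by (simp add: nn_integral_add mult.commute[of C])
  qed
  also have "\<dots> \<le> (\<integral>\<^sup>+b. \<integral>\<^sup>+a. F (a, b) * ennreal
        (5 / r * (indicator {-(2*r)..2*r} a * indicator {-(2*r)..2*r} b) +
         2 / \<bar>b\<bar> * (indicator {0..-b} a * indicator {-1..-r} b)) \<partial>lborel \<partial>lborel)"
    using r by (intro nn_integral_mono) (auto simp: indicator_def distrib_left)
  finally show ?thesis .
qed

text \<open>The weight has square integral at most \<open>M = 800 + 8 * ln (1 / r)\<close>: the square of area
  \<open>16 * r\<^sup>2\<close> contributes \<open>2 * 25 / r\<^sup>2 * 16 * r\<^sup>2\<close>, and the cone contributes the integral of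
  \<open>8 / t\<^sup>2\<close> times the length \<open>t\<close> of the section at depth \<open>t\<close>, for \<open>t\<close> from \<open>r\<close> to \<open>1\<close>. The
  overlap of square and cone is absorbed by \<open>(u + v)\<^sup>2 \<le> 2 * u\<^sup>2 + 2 * v\<^sup>2\<close>.\<close>

lemma Cauchy_Schwarz_box_cone:
  fixes F :: "real \<times> real \<Rightarrow> ennreal"
  assumes F[measurable]: "F \<in> borel_measurable (borel \<Otimes>\<^sub>M borel)" and r: "0 < r" "r < 1"
    and one: "1 \<le> (\<integral>\<^sup>+b. \<integral>\<^sup>+a. F (a, b) * ennreal
        (5 / r * (indicator {-(2*r)..2*r} a * indicator {-(2*r)..2*r} b) +
         2 / \<bar>b\<bar> * (indicator {0..-b} a * indicator {-1..-r} b)) \<partial>lborel \<partial>lborel)"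
  shows "1 \<le> ennreal (800 + 8 * ln (1 / r)) * (\<integral>\<^sup>+b. \<integral>\<^sup>+a. (F (a, b))\<^sup>2 \<partial>lborel \<partial>lborel)"
proof -
  define M where "M = 800 + 8 * ln (1 / r)"
  have M: "M > 0" using r by (simp add: M_def add_pos_nonneg)
  define w :: "real \<Rightarrow> real \<Rightarrow> real" where
    "w a b = 5 / r * (indicator {-(2*r)..2*r} a * indicator {-(2*r)..2*r} b) +
         2 / \<bar>b\<bar> * (indicator {0..-b} a * indicator {-1..-r} b)" for a b
  have [measurable]: "(\<lambda>x. w (fst x) (snd x)) \<in> borel_measurable (borel \<Otimes>\<^sub>M borel)"
    unfolding w_def by measurable
  have wm[measurable]: "(\<lambda>x. w (f x) (g x)) \<in> borel_measurable N"
    if [measurable]: "f \<in> borel_measurable N" "g \<in> borel_measurable N" for f g and N :: "'b measure"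
  proof -
    have "(\<lambda>x. (\<lambda>x. w (fst x) (snd x)) (f x, g x)) \<in> borel_measurable N" by measurable
    then show ?thesis by simp
  qed
  have w0: "0 \<le> w a b" for a b using r by (auto simp: w_def intro!: add_nonneg_nonneg)
  have wsq: "(\<integral>\<^sup>+b. \<integral>\<^sup>+a. ennreal ((w a b)\<^sup>2) \<partial>lborel \<partial>lborel) \<le> ennreal M"
  proof -
    have "ennreal ((w a b)\<^sup>2) \<le>
        ennreal (50 / r\<^sup>2) * indicator {-(2*r)..2*r} a * indicator {-(2*r)..2*r} b +
        ennreal (8 / b\<^sup>2) * indicator {0..-b} a * indicator {-1..-r} b" for a b
    proof -
      have "(x + y)\<^sup>2 \<le> 2 * x\<^sup>2 + 2 * y\<^sup>2" for x y :: real
        using zero_le_power2[of "x - y"] by (simp add: power2_eq_square algebra_simps)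
      note this[of "5 / r" "2 / \<bar>b\<bar>"]
      moreover have "25 / r\<^sup>2 \<le> 50 / r\<^sup>2" "4 / b\<^sup>2 \<le> 8 / b\<^sup>2"
        by (intro divide_right_mono; simp)+
      ultimately show ?thesis
        using r unfolding w_def
        by (auto simp: indicator_def power_divide simp flip: ennreal_plus intro!: ennreal_leI)
    qed
    then have "(\<integral>\<^sup>+b. \<integral>\<^sup>+a. ennreal ((w a b)\<^sup>2) \<partial>lborel \<partial>lborel) \<le>
       (\<integral>\<^sup>+b. \<integral>\<^sup>+a. ennreal (50 / r\<^sup>2) * indicator {-(2*r)..2*r} a * indicator {-(2*r)..2*r} b +
        ennreal (8 / b\<^sup>2) * indicator {0..-b} a * indicator {-1..-r} b \<partial>lborel \<partial>lborel)"
      by (intro nn_integral_mono)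
    also have "\<dots> = (\<integral>\<^sup>+b. ennreal (200 / r) * indicator {-(2*r)..2*r} b +
        ennreal (- 8 / b) * indicator {-1..-r} b \<partial>lborel)"
    proof (rule nn_integral_cong)
      fix b :: real
      have "(\<integral>\<^sup>+a. ennreal (50 / r\<^sup>2) * indicator {-(2*r)..2*r} a * indicator {-(2*r)..2*r} b +
        ennreal (8 / b\<^sup>2) * indicator {0..-b} a * indicator {-1..-r} b \<partial>lborel)
        = ennreal (50 / r\<^sup>2) * ennreal (4 * r) * indicator {-(2*r)..2*r} b +
          ennreal (8 / b\<^sup>2) * emeasure lborel {0..-b} * indicator {-1..-r} b"
        using r by (subst nn_integral_add) (auto simp: nn_integral_multc nn_integral_cmult)
      also have "\<dots> = ennreal (200 / r) * indicator {-(2*r)..2*r} b +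
        ennreal (- 8 / b) * indicator {-1..-r} b"
        using r by (auto simp: indicator_def power2_eq_square simp flip: ennreal_mult)
      finally show "(\<integral>\<^sup>+a. ennreal (50 / r\<^sup>2) * indicator {-(2*r)..2*r} a * indicator {-(2*r)..2*r} b +
        ennreal (8 / b\<^sup>2) * indicator {0..-b} a * indicator {-1..-r} b \<partial>lborel)
        = ennreal (200 / r) * indicator {-(2*r)..2*r} b +
        ennreal (- 8 / b) * indicator {-1..-r} b" .
    qed
    also have "\<dots> = ennreal (200 / r) * ennreal (4 * r)
        + (\<integral>\<^sup>+b. ennreal (- 8 / b) * indicator {-1..-r} b \<partial>lborel)"
      using r by (subst nn_integral_add) (auto simp: nn_integral_cmult)
    also have "(\<integral>\<^sup>+b. ennreal (- 8 / b) * indicator {-1..-r} b \<partial>lborel)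
        = ennreal (- 8 * ln (- (- r)) - - 8 * ln (- (- 1)))"
      using r by (intro nn_integral_FTC_Icc) (auto intro!: derivative_eq_intros simp: field_simps)
    also have "ennreal (200 / r) * ennreal (4 * r) = ennreal 800"
      using r by (simp flip: ennreal_mult)
    finally show ?thesis
      using r ennreal_plus[of 800 "- 8 * ln r"] by (simp add: M_def ln_div)
  qed
  define S where "S = (\<integral>\<^sup>+b. \<integral>\<^sup>+a. (F (a, b))\<^sup>2 \<partial>lborel \<partial>lborel)"
  \<comment> \<open>The choice \<open>M\<close> for the parameter of the weighted inequality makes the weight term at most one,
    half of the left-hand side.\<close>
  have "2 * 1 \<le> 2 * (\<integral>\<^sup>+b. \<integral>\<^sup>+a. F (a, b) * ennreal (w a b) \<partial>lborel \<partial>lborel)"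
    using one unfolding w_def by (intro mult_left_mono) auto
  also have "\<dots> = (\<integral>\<^sup>+b. \<integral>\<^sup>+a. 2 * (F (a, b) * ennreal (w a b)) \<partial>lborel \<partial>lborel)"
    by (simp add: nn_integral_cmult)
  also have "\<dots> \<le> (\<integral>\<^sup>+b. \<integral>\<^sup>+a. ennreal M * (F (a, b))\<^sup>2 + ennreal (1 / M) * ennreal ((w a b)\<^sup>2) \<partial>lborel \<partial>lborel)"
    using ennreal_two_mult_le[OF M w0] M
    by (intro nn_integral_mono) (simp flip: ennreal_mult)
  also have "\<dots> = ennreal M * S + ennreal (1 / M) * (\<integral>\<^sup>+b. \<integral>\<^sup>+a. ennreal ((w a b)\<^sup>2) \<partial>lborel \<partial>lborel)"
    by (simp add: nn_integral_add nn_integral_cmult S_def)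
  also have "\<dots> \<le> ennreal M * S + ennreal (1 / M) * ennreal M"
    using wsq by (intro add_left_mono mult_left_mono) auto
  also have "ennreal (1 / M) * ennreal M = 1"
    using M by (simp flip: ennreal_mult)
  finally have "1 + 1 \<le> 1 + ennreal M * S" by (simp add: add.commute)
  then show ?thesis
    unfolding M_def S_def by (subst (asm) ennreal_add_left_cancel_le) auto
qed

section \<open>Logarithmic lower bound for the modulus\<close>

text \<open>The bound on \<open>r\<close> ensures that the squares used, of half-side at most \<open>2 * r\<close>, lie in the
  unit disk about \<open>x0\<close> and hence in \<open>G\<close>.\<close>

lemma modulus_ge_log:
  fixes G K :: "(real^2) set"
  assumes G: "open G" "ball x0 1 \<subseteq> G" "\<And>m. m \<in> {0..1} \<Longrightarrow> x0 + vector [m, -1] \<notin> G"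
    and K: "connected K" "x0 \<in> K" "x0 + vector [2 * r, 0] \<in> K"
    and r: "0 < r" "r < 1 / 4"
  shows "ennreal (1 / (800 + 8 * ln (1 / r))) \<le> modulus (joining_curves K (frontier G) G)"
  unfolding modulus_def
proof (rule INF_greatest)
  fix \<sigma> assume adm: "\<sigma> \<in> admissible (joining_curves K (frontier G) G)"
  then have [measurable]: "\<sigma> \<in> borel_measurable borel" by (simp add: admissible_def)
  define F where "F z = \<sigma> (x0 + vector [fst z, snd z])" for z :: "real \<times> real"
  have [measurable]: "F \<in> borel_measurable (borel \<Otimes>\<^sub>M borel)"
  proof -
    have eq: "x0 + vector [fst z, snd z] = x0 + (fst z *\<^sub>R axis 1 1 + snd z *\<^sub>R axis 2 1)" for z :: "real \<times> real"
      by (auto simp: vec_eq_iff forall_2 axis_def)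
    show ?thesis unfolding F_def eq by measurable
  qed
  define M where "M = 800 + 8 * ln (1 / r)"
  have M: "M > 0" using r by (simp add: M_def add_pos_nonneg)
  have "1 \<le> ennreal M * (\<integral>\<^sup>+b. \<integral>\<^sup>+a. (F (a, b))\<^sup>2 \<partial>lborel \<partial>lborel)"
    unfolding M_def
  proof (rule Cauchy_Schwarz_box_cone[OF _ _ _ averaged_box_cone_bound])
    fix s m :: real assume s: "s \<in> {r..2*r}" and m: "m \<in> {0..1}"
    obtain a b where ab: "x0 + vector [a, b] \<in> K" "max \<bar>a\<bar> \<bar>b\<bar> = s"
      using connected_meets_square[OF K, of s] s r by auto
    have box: "x0 + vector [a, b] \<in> ball x0 1" if "\<bar>a\<bar> \<le> s" "\<bar>b\<bar> \<le> s" for a b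
    proof -
      have "\<bar>a\<bar> \<le> \<bar>1/2\<bar>" "\<bar>b\<bar> \<le> \<bar>1/2\<bar>" using that s r by auto
      then have "a\<^sup>2 \<le> (1/2)\<^sup>2" "b\<^sup>2 \<le> (1/2)\<^sup>2" by (simp_all only: abs_le_square_iff)
      then have "a\<^sup>2 + b\<^sup>2 < 1" by (simp add: power2_eq_square)
      then show ?thesis by (simp add: dist_norm norm_vector2)
    qed
    have dir: "x0 + t *\<^sub>R vector [m, -1] = x0 + vector [t * m, -t]" for t
      by (simp add: vec_eq_iff forall_2)
    have "x0 + s *\<^sub>R vector [m, -1] \<in> G"
      unfolding dir using m s r box[of "s * m" "-s"] G(2) by (auto simp: abs_mult mult_left_le)
    then obtain T where T: "s < T" "T \<le> 1" "x0 + T *\<^sub>R vector [m, -1] \<in> frontier G"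
      "open_segment (x0 + s *\<^sub>R vector [m, -1]) (x0 + T *\<^sub>R vector [m, -1]) \<subseteq> G"
      "x0 + s *\<^sub>R vector [m, -1] \<noteq> x0 + T *\<^sub>R vector [m, -1]"
      using first_exit[OF G(1), of s x0 "vector [m, -1]"] s r m G(3) by auto
    have "seg_integral \<sigma> (x0 + s *\<^sub>R vector [m, -1]) (x0 + T *\<^sub>R vector [m, -1])
        \<le> ennreal (norm (vector [m, -1] :: real^2)) * (\<integral>\<^sup>+t\<in>{r..1}. \<sigma> (x0 + t *\<^sub>R vector [m, -1]) \<partial>lborel)"
      using T s by (intro seg_integral_collinear_le) auto
    also have "\<dots> \<le> 2 * (\<integral>\<^sup>+t\<in>{r..1}. \<sigma> (x0 + t *\<^sub>R vector [m, -1]) \<partial>lborel)"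
    proof (rule mult_right_mono)
      have "m\<^sup>2 + 1 \<le> 2\<^sup>2" using m power_le_one[of m 2] by simp
      then have "norm (vector [m, -1] :: real^2) \<le> 2"
        unfolding norm_vector2 by (intro real_le_lsqrt) auto
      then show "ennreal (norm (vector [m, -1] :: real^2)) \<le> 2"
        using ennreal_leI by fastforce
    qed simp
    finally have rad: "seg_integral \<sigma> (x0 + s *\<^sub>R vector [m, -1]) (x0 + T *\<^sub>R vector [m, -1])
        \<le> 2 * (\<integral>\<^sup>+t\<in>{r..1}. F (t * m, - t) \<partial>lborel)"
      by (simp add: F_def dir)
    show "1 \<le> 2 * (\<integral>\<^sup>+a\<in>{-(2*r)..2*r}. F (a, -s) \<partial>lborel) + (\<integral>\<^sup>+a\<in>{-(2*r)..2*r}. F (a, s) \<partial>lborel)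
      + (\<integral>\<^sup>+b\<in>{-(2*r)..2*r}. F (s, b) \<partial>lborel) + (\<integral>\<^sup>+b\<in>{-(2*r)..2*r}. F (-s, b) \<partial>lborel)
      + 2 * (\<integral>\<^sup>+t\<in>{r..1}. F (t * m, - t) \<partial>lborel)"
    proof (rule admissible_connectable_to_frontier[OF adm _ ab(1) T(3) T(5) T(4) rad])
      show "connectable G \<sigma> (x0 + vector [a, b]) (x0 + s *\<^sub>R vector [m, -1])
        (2 * (\<integral>\<^sup>+a\<in>{-(2*r)..2*r}. F (a, -s) \<partial>lborel) + (\<integral>\<^sup>+a\<in>{-(2*r)..2*r}. F (a, s) \<partial>lborel)
      + (\<integral>\<^sup>+b\<in>{-(2*r)..2*r}. F (s, b) \<partial>lborel) + (\<integral>\<^sup>+b\<in>{-(2*r)..2*r}. F (-s, b) \<partial>lborel))"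
        unfolding dir F_def fst_conv snd_conv
        by (rule connectable_along_square[where U = "ball x0 1"]) (use box G ab s m in auto)
    qed
  qed (use r in auto)
  also have "(\<integral>\<^sup>+b. \<integral>\<^sup>+a. (F (a, b))\<^sup>2 \<partial>lborel \<partial>lborel) = (\<integral>\<^sup>+x. (\<sigma> x)\<^sup>2 \<partial>lborel)"
    unfolding F_def by (simp add: nn_integral_vec2[of "\<lambda>x. (\<sigma> x)\<^sup>2" x0])
  finally have "ennreal (1 / M) * 1 \<le> ennreal (1 / M) * (ennreal M * (\<integral>\<^sup>+x. (\<sigma> x)\<^sup>2 \<partial>lborel))"
    by (rule mult_left_mono) simp
  also have "\<dots> = (ennreal (1 / M) * ennreal M) * (\<integral>\<^sup>+x. (\<sigma> x)\<^sup>2 \<partial>lborel)"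
    by (simp add: mult.assoc)
  also have "ennreal (1 / M) * ennreal M = 1" using M by (simp flip: ennreal_mult)
  finally show "ennreal (1 / (800 + 8 * ln (1 / r))) \<le> (\<integral>\<^sup>+x. (\<sigma> x)\<^sup>2 \<partial>lborel)"
    by (simp add: M_def)
qed

lemma modulus_metric_ge_log:
  fixes G :: "(real^2) set"
  assumes "open G" "ball x0 1 \<subseteq> G" "\<And>m. m \<in> {0..1} \<Longrightarrow> x0 + vector [m, -1] \<notin> G"
    and "0 < r" "r < 1 / 4"
  shows "ennreal (1 / (800 + 8 * ln (1 / r))) \<le> modulus_metric G x0 (x0 + vector [2 * r, 0])"
  unfolding modulus_metric_def using assms by (intro INF_greatest modulus_ge_log) auto

section \<open>Comparison with the hyperbolic metrics\<close>

lemma arsinh_real_le_self: "arsinh x \<le> (x :: real)" if "0 \<le> x"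
proof -
  have "sinh 0 - 0 \<le> sinh x - x"
  proof (rule DERIV_nonneg_imp_nondecreasing[OF that, where f = "\<lambda>t. sinh t - t"], intro exI conjI)
    fix t :: real
    show "((\<lambda>t. sinh t - t) has_real_derivative cosh t - 1) (at t)"
      by (auto intro!: derivative_eq_intros)
  qed (simp add: cosh_real_ge_1)
  then show ?thesis
    using sinh_real_le_iff[of "arsinh x" x] by (simp add: sinh_arsinh_real)
qed

lemma rho_half_plane_le:
  assumes "0 < r"
  shows "rho_half_plane (vector [0, 1]) (vector [0, 1] + vector [2 * r, 0]) \<le> 8 * r"
proof -
  let ?x = "vector [0, 1] :: real^2" and ?y = "vector [0, 1] + vector [2 * r, 0] :: real^2"
  have "cosh (rho_half_plane ?x ?y) = 1 + 2 * r\<^sup>2"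
    using cosh_rho_half_plane(1)[of ?x ?y] by (simp add: upper_half_plane_def norm_vector2)
  also have "\<dots> = cosh (2 * arsinh r)"
    by (simp add: cosh_double cosh_square_eq sinh_arsinh_real)
  finally have "rho_half_plane ?x ?y = 2 * arsinh r"
    using cosh_rho_half_plane(2)[of ?x ?y] assms
    by (subst (asm) cosh_real_eq_iff) (auto simp: upper_half_plane_def abs_of_nonneg less_imp_le)
  then show ?thesis using arsinh_real_le_self[of r] assms by simp
qed

lemma rho_disk_le:
  assumes "0 < r" "r < 1 / 4"
  shows "rho_disk 0 (0 + vector [2 * r, 0]) \<le> 8 * r"
proof -
  have "(2 * r)\<^sup>2 \<le> (1 / 2)\<^sup>2" using assms by (intro power_mono) auto
  then have "1 / 4 \<le> 1 - (2 * r)\<^sup>2" by (simp add: power2_eq_square)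
  then have "(2 * r)\<^sup>2 / (1 - (2 * r)\<^sup>2) \<le> (2 * r)\<^sup>2 / (1 / 4)"
    by (intro divide_left_mono) auto
  also have "\<dots> = (4 * r)\<^sup>2" by (simp add: power2_eq_square)
  finally have "sqrt ((2 * r)\<^sup>2 / (1 - (2 * r)\<^sup>2)) \<le> 4 * r"
    using assms by (intro real_le_lsqrt) auto
  moreover have "rho_disk 0 (0 + vector [2 * r, 0]) = 2 * arsinh (sqrt ((2 * r)\<^sup>2 / (1 - (2 * r)\<^sup>2)))"
    by (simp add: rho_disk_def norm_vector2 power_mult_distrib)
  ultimately show ?thesis
    using arsinh_real_le_self[of "sqrt ((2 * r)\<^sup>2 / (1 - (2 * r)\<^sup>2))"] \<open>1 / 4 \<le> _\<close>
    by simp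
qed

theorem theorem1p6:
  fixes D :: "(real^2) set" and \<rho> :: "real^2 \<Rightarrow> real^2 \<Rightarrow> real"
  assumes "D = upper_half_plane \<and> \<rho> = rho_half_plane \<or> D = unit_disk \<and> \<rho> = rho_disk"
  shows "\<not> (\<exists>C \<alpha> :: real. C > 0 \<and> \<alpha> > 0 \<and>
            (\<forall>x\<in>D. \<forall>y\<in>D. modulus_metric D x y \<le> ennreal (C * \<rho> x y powr \<alpha>)))"
proof
  assume "\<exists>C \<alpha> :: real. C > 0 \<and> \<alpha> > 0 \<and>
            (\<forall>x\<in>D. \<forall>y\<in>D. modulus_metric D x y \<le> ennreal (C * \<rho> x y powr \<alpha>))"
  then obtain C \<alpha> where C: "C > 0" "\<alpha> > 0"
    and hoelder: "\<And>x y. x \<in> D \<Longrightarrow> y \<in> D \<Longrightarrow> modulus_metric D x y \<le> ennreal (C * \<rho> x y powr \<alpha>)"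
    by blast
  obtain x0 where D: "open D" "ball x0 1 \<subseteq> D" "\<And>m. m \<in> {0..1} \<Longrightarrow> x0 + vector [m, -1] \<notin> D"
    and \<rho>: "\<And>r. 0 < r \<Longrightarrow> r < 1 / 4 \<Longrightarrow> \<rho> x0 (x0 + vector [2 * r, 0]) \<le> 8 * r"
    and \<rho>0: "\<And>x y. x \<in> D \<Longrightarrow> y \<in> D \<Longrightarrow> 0 \<le> \<rho> x y"
  proof (cases "D = upper_half_plane \<and> \<rho> = rho_half_plane")
    case True
    show ?thesis
    proof (rule that[of "vector [0, 1]"])
      show "open D"
        using True by (auto simp: upper_half_plane_def intro!: open_Collect_less continuous_intros)
      show "ball (vector [0, 1]) 1 \<subseteq> D"
      proof
        fix z :: "real^2" assume "z \<in> ball (vector [0, 1]) 1"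
        then have "\<bar>(vector [0, 1] - z) $ 2\<bar> < 1"
          using component_le_norm_cart[of "vector [0, 1] - z" 2] by (simp add: dist_norm)
        then show "z \<in> D" using True by (simp add: upper_half_plane_def)
      qed
    qed (use True cosh_rho_half_plane(2) rho_half_plane_le in \<open>auto simp: upper_half_plane_def\<close>)
  next
    case False
    then have D: "D = unit_disk" "\<rho> = rho_disk" using assms by auto
    \<comment> \<open>The vectors \<open>(m, -1)\<close> have norm at least one, so they lie outside the open disk.\<close>
    show ?thesis
    proof (rule that[of 0])
      show "0 + vector [m, -1] \<notin> D" for m
        by (simp add: D unit_disk_def norm_vector2)
    qed (use sinh_rho_disk(2) rho_disk_le in \<open>auto simp: D unit_disk_def\<close>)
  qed
  have lower: "1 / (800 + 8 * ln (1 / r)) \<le> C * (8 * r) powr \<alpha>" if r: "0 < r" "r < 1 / 4" for r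
  proof -
    have y: "x0 + vector [2 * r, 0] \<in> D" using r abs_square_less_1[of "2 * r"]
      by (intro subsetD[OF D(2)]) (auto simp: dist_norm norm_vector2)
    have x: "x0 \<in> D" using D(2) by auto
    have "ennreal (1 / (800 + 8 * ln (1 / r))) \<le> modulus_metric D x0 (x0 + vector [2 * r, 0])"
      using D r by (rule modulus_metric_ge_log)
    also have "\<dots> \<le> ennreal (C * \<rho> x0 (x0 + vector [2 * r, 0]) powr \<alpha>)"
      by (rule hoelder[OF x y])
    also have "\<dots> \<le> ennreal (C * (8 * r) powr \<alpha>)"
      using C \<rho>[OF r] \<rho>0[OF x y] by (intro ennreal_leI mult_left_mono powr_mono2) auto
    finally show ?thesis using C by (simp add: ennreal_le_iff)
  qed
  \<comment> \<open>A power of \<open>r\<close> beats the logarithm as \<open>r\<close> tends to zero.\<close>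
  have "((\<lambda>r. C * (8 * r) powr \<alpha> * (800 + 8 * ln (1 / r))) \<longlongrightarrow> 0) (at_right 0)"
    using C by real_asymp
  then have "eventually (\<lambda>r. C * (8 * r) powr \<alpha> * (800 + 8 * ln (1 / r)) < 1) (at_right 0)"
    by (rule order_tendstoD) simp
  moreover have "eventually (\<lambda>r::real. r \<in> {0<..<1/4}) (at_right 0)"
    by (rule eventually_at_right_real) simp
  ultimately have "eventually (\<lambda>r::real. False) (at_right 0)"
  proof eventually_elim
    case (elim r)
    then have "0 < 800 + 8 * ln (1 / r)" by (simp add: add_pos_nonneg)
    then show False using lower[of r] elim by (simp add: field_simps)
  qed
  then show False by simp
qed

end
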